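(* Let $(\mathcal{A},\varphi)$ be a $C^*$-probability space and let $X_1,\dots,X_d\in\mathcal{A}$ be selfadjoint. Let $p\in\mathbb{C}\langle x_1,\dots,x_d\rangle$ be a selfadjoint polynomial and let $\hat p=b_0\otimes 1+b_1\otimes x_1+\cdots+b_d\otimes x_d$, with $b_0,b_1,\dots,b_d\in M_n(\mathbb{C})$, be a selfadjoint linearization of $p$. Put $P:=p(X_1,\dots,X_d)\in\mathcal{A}$ and $$\hat P:=\hat p(X_1,\dots,X_d)=b_0\otimes 1+b_1\otimes X_1+\cdots+b_d\otimes X_d\in M_n(\mathcal{A}).$$ For $z\in\mathbb{C}$ with $\operatorname{Im}z>0$ and $\varepsilon>0$ let $\Lambda(z)=\operatorname{diag}(z,0,\dots,0)\in M_n(\mathbb{C})$ and $\Lambda_\varepsilon(z)=\operatorname{diag}(z,i\varepsilon,\dots,i\varepsilon)\in M_n(\mathbb{C})$. Then for every $z\in\mathbb{C}$ with $\operatorname{Im}z>0$ the element $\Lambda(z)-\hat P$ is invertible in $M_n(\mathcal{A})$ (so that $G_{\hat P}(\Lambda(z))$ is defined) and $$G_P(z)=\bigl[G_{\hat P}(\Lambda(z))\bigr]_{1,1}=\lim_{\varepsilon\searrow 0}\bigl[G_{\hat P}(\Lambda_\varepsilon(z))\bigr]_{1,1}.$$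
   Context: A $C^*$-probability space $(\mathcal{A},\varphi)$ is a unital $C^*$-algebra $\mathcal{A}$ with a state $\varphi$. $\mathbb{C}\langle x_1,\dots,x_d\rangle$ is the unital $*$-algebra of polynomials in non-commuting indeterminates with $x_i^*=x_i$; selfadjoint means $p=p^*$, and for matrices over this algebra $(a_{ij})^*=(a_{ji}^* )$. A linearization of $p$ is a matrix $\hat p=\begin{pmatrix}0&u\\ v&q\end{pmatrix}\in M_n(\mathbb{C}\langle x_1,\dots,x_d\rangle)$, where $q$ is an $(n-1)\times(n-1)$ matrix invertible over $\mathbb{C}\langle x_1,\dots,x_d\rangle$, $u$ is a $1\times(n-1)$ row, $v$ an $(n-1)\times 1$ column, such that $\hat p$ is affine, i.e. of the form $b_0\otimes 1+\sum_{i=1}^d b_i\otimes x_i$ with $b_i\in M_n(\mathbb{C})$, and $p=-uq^{-1}v$. It is selfadjoint if $\hat p=\hat p^*$. $G_P(z)=\varphi[(z-P)^{-1}]$ is the scalar Cauchy transform, and $G_{\hat P}(b)=(\mathrm{id}\otimes\varphi)[(b-\hat P)^{-1}]\in M_n(\mathbb{C})$ for each $b\in M_n(\mathbb{C})$ such that $b-\hat P$ is invertible in $M_n(\mathcal{A})$; here $\mathrm{id}\otimes\varphi$ applies $\varphi$ entrywise. $[\cdot]_{1,1}$ denotes the $(1,1)$-entry. *)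

theory Defs
  imports
    "HOL-Analysis.Analysis"
    "HOL-Library.Poly_Mapping"
    "Jordan_Normal_Form.Matrix"
begin

section \<open>\<open>C\<^sup>*\<close>-probability spaces\<close>

text \<open>Unital, nonzero complex \<open>C\<^sup>*\<close>-algebras. The real Banach algebra structure comes from the
  library classes (which also give \<open>norm 1 = 1\<close>); \<open>scaleC\<close> extends its real scalar multiplication.\<close>

class cstar_algebra = real_normed_algebra_1 + banach +
  fixes scaleC :: "complex \<Rightarrow> 'a \<Rightarrow> 'a"
    and star :: "'a \<Rightarrow> 'a"
  assumes scaleC_of_real: "scaleC (complex_of_real r) x = scaleR r x"
    and scaleC_add_left: "scaleC (c + d) x = scaleC c x + scaleC d x"
    and scaleC_add_right: "scaleC c (x + y) = scaleC c x + scaleC c y"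
    and scaleC_scaleC: "scaleC c (scaleC d x) = scaleC (c * d) x"
    and mult_scaleC_left: "scaleC c x * y = scaleC c (x * y)"
    and mult_scaleC_right: "x * scaleC c y = scaleC c (x * y)"
    and norm_scaleC: "norm (scaleC c x) = cmod c * norm x"
    and star_star: "star (star x) = x"
    and star_add: "star (x + y) = star x + star y"
    and star_scaleC: "star (scaleC c x) = scaleC (cnj c) (star x)"
    and star_mult: "star (x * y) = star y * star x"
    and cstar_identity: "norm (star x * x) = (norm x)\<^sup>2"

instantiation complex :: cstar_algebra
begin

definition scaleC_complex :: "complex \<Rightarrow> complex \<Rightarrow> complex" where
  "scaleC_complex c x = c * x"

definition star_complex :: "complex \<Rightarrow> complex" where
  "star_complex = cnj"

instance
  by standard
    (simp_all add: scaleC_complex_def star_complex_def scaleR_conv_of_real algebra_simps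
      norm_mult power2_eq_square)

end

definition selfadjoint :: "'a::cstar_algebra \<Rightarrow> bool" where
  "selfadjoint x \<longleftrightarrow> star x = x"

text \<open>Boundedness and \<open>\<parallel>\<phi>\<parallel> = 1\<close> follow from positivity and \<open>\<phi> 1 = 1\<close>.\<close>

definition state :: "('a::cstar_algebra \<Rightarrow> complex) \<Rightarrow> bool" where
  "state \<phi> \<longleftrightarrow>
     (\<forall>x y. \<phi> (x + y) = \<phi> x + \<phi> y) \<and>
     (\<forall>c x. \<phi> (scaleC c x) = c * \<phi> x) \<and>
     (\<forall>x. \<phi> (star x * x) \<in> \<real> \<and> 0 \<le> Re (\<phi> (star x * x))) \<and>
     \<phi> 1 = 1"


section \<open>Inverses\<close>

definition invertible_elem :: "'a::ring_1 \<Rightarrow> bool" where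
  "invertible_elem x \<longleftrightarrow> (\<exists>y. x * y = 1 \<and> y * x = 1)"

text \<open>Unspecified if the argument is not invertible; likewise for \<open>mat_inv\<close>.\<close>

definition ring_inv :: "'a::ring_1 \<Rightarrow> 'a" where
  "ring_inv x = (THE y. x * y = 1 \<and> y * x = 1)"

definition mat_inv :: "'a::ring_1 mat \<Rightarrow> 'a mat" where
  "mat_inv A = (THE B. inverts_mat A B \<and> inverts_mat B A)"

lemma ring_inv_eqI:
  assumes "x * y = 1" "y * x = 1"
  shows "ring_inv x = y"
  unfolding ring_inv_def using assms
  by (intro the_equality) (auto, metis mult.assoc mult_1_left mult_1_right)

lemma mat_inv_eqI:
  assumes A: "A \<in> carrier_mat n n" and AB: "inverts_mat A B" and BA: "inverts_mat B A"
  shows "mat_inv A = B"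
  unfolding mat_inv_def
proof (rule the_equality)
  have dim: "C \<in> carrier_mat n n" if "inverts_mat A C" "inverts_mat C A" for C
  proof
    have "dim_col (A * C) = dim_row A" "dim_col (C * A) = dim_row C"
      using that by (simp_all only: inverts_mat_def index_one_mat)
    with A show "dim_row C = n" "dim_col C = n" by auto
  qed
  show "inverts_mat A B \<and> inverts_mat B A" using AB BA ..
  fix C assume C: "inverts_mat A C \<and> inverts_mat C A"
  have B': "B \<in> carrier_mat n n" and C': "C \<in> carrier_mat n n"
    using dim AB BA C by auto
  have "C = C * (A * B)" using AB A C' by (simp add: inverts_mat_def)
  also have "\<dots> = (C * A) * B" using assoc_mult_mat[OF C' A B'] by simp
  also have "\<dots> = B" using C C' B' by (simp add: inverts_mat_def)
  finally show "C = B" .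
qed


section \<open>Noncommutative polynomials\<close>

text \<open>The free monoid, written additively as required by the convolution product of
  \<^theory>\<open>HOL-Library.Poly_Mapping\<close>; its monoid algebra over the complex numbers is the algebra of
  polynomials in noncommuting indeterminates indexed by \<open>'d\<close>.\<close>

datatype 'd ncmonom = Monom (letters: "'d list")

instantiation ncmonom :: (type) monoid_add
begin

definition zero_ncmonom :: "'a ncmonom" where
  "0 = Monom []"

definition plus_ncmonom :: "'a ncmonom \<Rightarrow> 'a ncmonom \<Rightarrow> 'a ncmonom" where
  "v + w = Monom (letters v @ letters w)"

instance
  by standard (simp_all add: zero_ncmonom_def plus_ncmonom_def)

end

type_synonym 'd ncpoly = "'d ncmonom \<Rightarrow>\<^sub>0 complex"

definition nc_const :: "complex \<Rightarrow> 'd ncpoly" where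
  "nc_const c = Poly_Mapping.single 0 c"

definition nc_var :: "'d \<Rightarrow> 'd ncpoly" where
  "nc_var i = Poly_Mapping.single (Monom [i]) 1"

definition monom_rev :: "'d ncmonom \<Rightarrow> 'd ncmonom" where
  "monom_rev w = Monom (rev (letters w))"

lemma monom_rev_rev [simp]: "monom_rev (monom_rev w) = w"
  by (simp add: monom_rev_def)

text \<open>The conjugate-linear antimultiplicative involution fixing the indeterminates.\<close>

lift_definition nc_star :: "'d ncpoly \<Rightarrow> 'd ncpoly" is
  "\<lambda>p w. cnj (p (monom_rev w))"
proof -
  fix p :: "'d ncmonom \<Rightarrow> complex"
  assume fin: "finite {w. p w \<noteq> 0}"
  have "{w. cnj (p (monom_rev w)) \<noteq> 0} \<subseteq> monom_rev ` {w. p w \<noteq> 0}"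
    by (auto simp: image_iff) (metis monom_rev_rev)
  with fin show "finite {w. cnj (p (monom_rev w)) \<noteq> 0}"
    using finite_surj by blast
qed

definition nc_eval :: "('d \<Rightarrow> 'a::cstar_algebra) \<Rightarrow> 'd ncpoly \<Rightarrow> 'a" where
  "nc_eval X p =
     (\<Sum>w\<in>Poly_Mapping.keys p. scaleC (Poly_Mapping.lookup p w) (prod_list (map X (letters w))))"


section \<open>Linearizations\<close>

text \<open>For an algebra with scalar embedding \<open>\<iota> c = c \<cdot> 1\<close>, the matrix
  \<open>b\<^sub>0 \<otimes> 1 + \<Sum>\<^sub>i b\<^sub>i \<otimes> x\<^sub>i\<close>.\<close>

definition pencil ::
    "(complex \<Rightarrow> 'r::ring_1) \<Rightarrow> complex mat \<Rightarrow> ('d::finite \<Rightarrow> complex mat) \<Rightarrow> ('d \<Rightarrow> 'r) \<Rightarrow> 'r mat" where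
  "pencil \<iota> b0 b x =
     mat (dim_row b0) (dim_col b0)
       (\<lambda>(j, k). \<iota> (b0 $$ (j, k)) + (\<Sum>i\<in>UNIV. \<iota> (b i $$ (j, k)) * x i))"

definition nc_affine :: "nat \<Rightarrow> ('d::finite) ncpoly mat \<Rightarrow> bool" where
  "nc_affine n ph \<longleftrightarrow>
     (\<exists>b0 b. b0 \<in> carrier_mat n n \<and> (\<forall>i. b i \<in> carrier_mat n n) \<and> ph = pencil nc_const b0 b nc_var)"

text \<open>In the last conjunct \<open>p\<close> is identified with a \<open>1 \<times> 1\<close> matrix.\<close>

definition linearization :: "nat \<Rightarrow> ('d::finite) ncpoly mat \<Rightarrow> 'd ncpoly \<Rightarrow> bool" where
  "linearization n ph p \<longleftrightarrow>
     n \<ge> 1 \<and> nc_affine n ph \<and>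
     (\<exists>u v q. u \<in> carrier_mat 1 (n - 1) \<and> v \<in> carrier_mat (n - 1) 1 \<and>
        q \<in> carrier_mat (n - 1) (n - 1) \<and> invertible_mat q \<and>
        ph = four_block_mat (0\<^sub>m 1 1) u v q \<and>
        mat 1 1 (\<lambda>_. p) = - (u * mat_inv q * v))"

definition nc_mat_star :: "'d ncpoly mat \<Rightarrow> 'd ncpoly mat" where
  "nc_mat_star A = mat (dim_col A) (dim_row A) (\<lambda>(j, k). nc_star (A $$ (k, j)))"

definition selfadjoint_linearization :: "nat \<Rightarrow> ('d::finite) ncpoly mat \<Rightarrow> 'd ncpoly \<Rightarrow> bool" where
  "selfadjoint_linearization n ph p \<longleftrightarrow> linearization n ph p \<and> nc_mat_star ph = ph"


section \<open>Cauchy transforms\<close>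

definition scalar_elem :: "complex \<Rightarrow> 'a::cstar_algebra" where
  "scalar_elem c = scaleC c 1"

definition scalar_mat :: "complex mat \<Rightarrow> 'a::cstar_algebra mat" where
  "scalar_mat b = map_mat scalar_elem b"

definition cauchy_transform :: "('a::cstar_algebra \<Rightarrow> complex) \<Rightarrow> 'a \<Rightarrow> complex \<Rightarrow> complex" where
  "cauchy_transform \<phi> P z = \<phi> (ring_inv (scalar_elem z - P))"

definition mat_cauchy_transform ::
    "('a::cstar_algebra \<Rightarrow> complex) \<Rightarrow> 'a mat \<Rightarrow> complex mat \<Rightarrow> complex mat" where
  "mat_cauchy_transform \<phi> A b = map_mat \<phi> (mat_inv (scalar_mat b - A))"

text \<open>\<open>Lambda_mat n \<epsilon> z\<close> is \<open>diag(z, i\<epsilon>, \<dots>, i\<epsilon>)\<close>; for \<open>\<epsilon> = 0\<close> it is \<open>diag(z, 0, \<dots>, 0)\<close>.\<close>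

definition Lambda_mat :: "nat \<Rightarrow> real \<Rightarrow> complex \<Rightarrow> complex mat" where
  "Lambda_mat n \<epsilon> z =
     mat n n (\<lambda>(j, k). if j = k then (if j = 0 then z else \<i> * complex_of_real \<epsilon>) else 0)"


section \<open>Evaluating a pencil\<close>

lemma scaleC_0_left [simp]: "scaleC 0 (x::'a::cstar_algebra) = 0"
  using scaleC_of_real[of 0 x] by simp

lemma scaleC_1_left [simp]: "scaleC 1 (x::'a::cstar_algebra) = x"
  using scaleC_of_real[of 1 x] by simp

lemma nc_eval_superset:
  assumes "finite S" "Poly_Mapping.keys p \<subseteq> S"
  shows "nc_eval X p =
    (\<Sum>w\<in>S. scaleC (Poly_Mapping.lookup p w) (prod_list (map X (letters w))))"
  unfolding nc_eval_def using assms
  by (intro sum.mono_neutral_left) (auto simp: in_keys_iff)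

lemma nc_eval_add: "nc_eval X (p + q) = nc_eval X p + nc_eval X q"
proof -
  let ?S = "Poly_Mapping.keys p \<union> Poly_Mapping.keys q"
  have "Poly_Mapping.keys (p + q) \<subseteq> ?S" by (rule keys_add)
  then show ?thesis
    by (simp add: nc_eval_superset[of ?S] lookup_add scaleC_add_left sum.distrib)
qed

lemma nc_eval_single:
  "nc_eval X (Poly_Mapping.single w c) = scaleC c (prod_list (map X (letters w)))"
  by (simp add: nc_eval_def)

lemma nc_eval_sum: "finite I \<Longrightarrow> nc_eval X (\<Sum>i\<in>I. f i) = (\<Sum>i\<in>I. nc_eval X (f i))"
  by (induction I rule: finite_induct) (simp_all add: nc_eval_add, simp add: nc_eval_def)

lemma map_mat_nc_eval_pencil:
  "map_mat (nc_eval X) (pencil nc_const b0 b nc_var) = pencil scalar_elem b0 b X"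
  by (intro eq_matI)
    (auto simp: pencil_def nc_eval_add nc_eval_sum nc_const_def nc_var_def mult_single
      nc_eval_single scalar_elem_def mult_scaleC_left zero_ncmonom_def plus_ncmonom_def)

end

theory Submission
  imports Defs
begin

text \<open>Write \<open>P\<^sub>L\<close> for the evaluated linearization. With \<open>p = -u q\<^bsup>-1\<^esup> v\<close>, the Schur
  complement of the lower right block of \<open>\<Lambda>(z) - P\<^sub>L\<close> is \<open>z - P\<close>. This is invertible because \<open>P\<close> is selfadjoint, so block inversion
  shows that \<open>\<Lambda>(z) - P\<^sub>L\<close> is invertible and that the corner of its inverse is \<open>(z - P)\<^bsup>-1\<^esup>\<close>.
  Since inversion of matrices over a Banach algebra is continuous for entrywise convergence and
  states are bounded, the limit \<open>\<epsilon> \<longrightarrow> 0\<close> follows.\<close>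


section \<open>Inversion in Banach algebras\<close>

text \<open>A relation rather than a function, so that explicit inverses can be carried through
  series and block formulas; the link to \<open>ring_inv\<close> is made only at the end, by
  uniqueness.\<close>

definition is_inv :: "'a::ring_1 \<Rightarrow> 'a \<Rightarrow> bool" where
  "is_inv x y \<longleftrightarrow> x * y = 1 \<and> y * x = 1"

definition neumann :: "'a::{real_normed_algebra_1,banach} \<Rightarrow> 'a" where
  "neumann x = suminf (\<lambda>k. x ^ k)"

lemma neumann_eq:
  fixes x :: "'a::{real_normed_algebra_1,banach}"
  assumes "norm x < 1"
  shows "neumann x = 1 + x * neumann x" "neumann x = 1 + neumann x * x"
proof -
  have S: "summable (\<lambda>k. x ^ k)"
    using assms by (rule complete_algebra_summable_geometric)
  have "neumann x = 1 + suminf (\<lambda>k. x ^ Suc k)"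
    using suminf_split_head[OF S] by (simp add: neumann_def)
  moreover have "suminf (\<lambda>k. x ^ Suc k) = x * neumann x"
    using suminf_mult[OF S] by (simp add: neumann_def)
  moreover have "suminf (\<lambda>k. x ^ Suc k) = neumann x * x"
    using suminf_mult2[OF S] by (simp add: neumann_def power_commutes)
  ultimately show "neumann x = 1 + x * neumann x" "neumann x = 1 + neumann x * x"
    by simp_all
qed

lemma is_inv_neumann:
  fixes x :: "'a::{real_normed_algebra_1,banach}"
  assumes "norm x < 1"
  shows "is_inv (1 - x) (neumann x)"
  using neumann_eq[OF assms] by (simp add: is_inv_def algebra_simps)

text \<open>The equation N = 1 + x N gives |N| \<le> 1 + |N|/2, hence |N| \<le> 2, and so N - 1 = x
  N has norm at most 2 |x|.\<close>

lemma norm_neumann_diff_one: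
  fixes x :: "'a::{real_normed_algebra_1,banach}"
  assumes "norm x \<le> 1 / 2"
  shows "norm (neumann x - 1) \<le> 2 * norm x"
proof -
  let ?N = "neumann x"
  have eq: "?N = 1 + x * ?N" using assms by (intro neumann_eq) simp
  have "norm ?N = norm (1 + x * ?N)" using eq by simp
  also have "\<dots> \<le> 1 + norm (x * ?N)" using norm_triangle_ineq[of 1 "x * ?N"] by simp
  also have "norm (x * ?N) \<le> norm x * norm ?N" by (rule norm_mult_ineq)
  also have "\<dots> \<le> 1 / 2 * norm ?N" using assms by (intro mult_right_mono) auto
  finally have N: "norm ?N \<le> 2" by simp
  have "?N - 1 = x * ?N" using eq by (metis add_diff_cancel_left')
  then have "norm (?N - 1) = norm (x * ?N)" by simp
  also have "\<dots> \<le> norm x * norm ?N" by (rule norm_mult_ineq)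
  also have "\<dots> \<le> norm x * 2" using N by (intro mult_left_mono) auto
  finally show ?thesis by simp
qed

text \<open>The witness is the Neumann series of 1 - f e. It inverts f e as soon as |1 - f e| < 1/2,
  which holds eventually; its values elsewhere do not affect the limit.\<close>

lemma tendsto_ring_inverse_one:
  fixes f :: "'b \<Rightarrow> 'a::{real_normed_algebra_1,banach}"
  assumes f: "(f \<longlongrightarrow> 1) F"
  obtains g where "\<forall>\<^sub>F e in F. is_inv (f e) (g e)" "(g \<longlongrightarrow> 1) F"
proof
  have lim: "((\<lambda>e. norm (1 - f e)) \<longlongrightarrow> 0) F"
    using tendsto_norm[OF tendsto_diff[OF tendsto_const[of 1] f]] by simp
  have ev: "\<forall>\<^sub>F e in F. norm (1 - f e) < 1 / 2"
    using order_tendstoD(2)[OF lim, of "1 / 2"] by simp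
  show "\<forall>\<^sub>F e in F. is_inv (f e) (neumann (1 - f e))"
    using ev
  proof eventually_elim
    case (elim e)
    then show ?case using is_inv_neumann[of "1 - f e"] by simp
  qed
  have "((\<lambda>e. neumann (1 - f e) - 1) \<longlongrightarrow> 0) F"
  proof (rule Lim_null_comparison)
    show "\<forall>\<^sub>F e in F. norm (neumann (1 - f e) - 1) \<le> 2 * norm (1 - f e)"
      using ev by eventually_elim (rule norm_neumann_diff_one, simp)
    show "((\<lambda>e. 2 * norm (1 - f e)) \<longlongrightarrow> 0) F"
      using tendsto_mult_right_zero[OF lim] by simp
  qed
  then show "((\<lambda>e. neumann (1 - f e)) \<longlongrightarrow> 1) F"
    by (rule Lim_null[THEN iffD2])
qed


section \<open>Involution, resolvents and states\<close>

lemma scaleC_zero_right [simp]: "scaleC c (0::'a::cstar_algebra) = 0"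
  using scaleC_add_right[of c 0 "0::'a"] by simp

lemma scaleC_minus_left [simp]: "scaleC (- c) (x::'a::cstar_algebra) = - scaleC c x"
  using scaleC_add_left[of c "- c" x] by (simp add: eq_neg_iff_add_eq_0 add.commute)

lemma scaleC_minus_right [simp]: "scaleC c (- x) = - scaleC c (x::'a::cstar_algebra)"
  using scaleC_add_right[of c x "- x"] by (simp add: eq_neg_iff_add_eq_0 add.commute)

lemma scaleC_diff_right: "scaleC c (x - y) = scaleC c x - scaleC c (y::'a::cstar_algebra)"
  using scaleC_add_right[of c x "- y"] by simp

lemma star_zero [simp]: "star (0::'a::cstar_algebra) = 0"
  using star_add[of 0 "0::'a"] by simp

lemma star_minus [simp]: "star (- x) = - star (x::'a::cstar_algebra)"
  using star_add[of x "- x"] by (simp add: eq_neg_iff_add_eq_0 add.commute)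

lemma star_diff: "star (x - y) = star x - star (y::'a::cstar_algebra)"
  using star_add[of x "- y"] by simp

lemma star_one [simp]: "star (1::'a::cstar_algebra) = 1"
  using star_mult[of "star 1" "1::'a"] by (simp add: star_star)

lemma star_scaleR: "star (r *\<^sub>R x) = r *\<^sub>R star (x::'a::cstar_algebra)"
  using star_scaleC[of "complex_of_real r" x] by (simp add: scaleC_of_real)

lemma star_sum: "star (\<Sum>i\<in>I. f i :: 'a::cstar_algebra) = (\<Sum>i\<in>I. star (f i))"
  by (induction I rule: infinite_finite_induct) (simp_all add: star_add)

lemma star_power: "star (x ^ k) = star (x::'a::cstar_algebra) ^ k"
  by (induction k) (simp_all add: star_mult power_commutes)

text \<open>The C*-identity and submultiplicativity give |y|^2 \<le> |y*| |y|, hence |y| \<le> |y*|;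
  taking y = x and y = x* yields equality.\<close>

lemma norm_star [simp]: "norm (star x) = norm (x::'a::cstar_algebra)"
proof -
  have le: "norm y \<le> norm (star y)" for y :: 'a
  proof (cases "y = 0")
    case False
    have "norm y * norm y \<le> norm (star y) * norm y"
      using norm_mult_ineq[of "star y" y] cstar_identity[of y] by (simp add: power2_eq_square)
    then show ?thesis using False by simp
  qed simp
  show ?thesis using le[of x] le[of "star x"] by (simp add: star_star)
qed

text \<open>Continuity of the involution allows it to be applied termwise to the binomial series
  below.\<close>

lemma bounded_linear_star: "bounded_linear (star :: 'a::cstar_algebra \<Rightarrow> 'a)"
  by (rule bounded_linear_intro[of _ 1]) (simp_all add: star_add star_scaleR)

text \<open>Arens' trick: \<open>h - i s = (h + i t) - i (s + t)\<close> and
  \<open>\<parallel>h + i t\<parallel>\<^sup>2 \<le> \<parallel>h\<parallel>\<^sup>2 + t\<^sup>2 < (s + t)\<^sup>2\<close> for large \<open>t\<close>,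
  so a Neumann series inverts it.\<close>

lemma invertible_resolvent_selfadjoint:
  fixes P :: "'a::cstar_algebra"
  assumes P: "selfadjoint P" and z: "Im z > 0"
  shows "\<exists>y. is_inv (scalar_elem z - P) y"
proof -
  define s where "s = Im z"
  define h where "h = P - scaleC (of_real (Re z)) 1"
  \<comment> \<open>This value makes s t = |h|^2 + 1, so that the cross term 2 s t of (s + t)^2
    exceeds |h|^2.\<close>
  define t where "t = ((norm h)\<^sup>2 + 1) / s"
  define w where "w = h + scaleC (\<i> * of_real t) 1"
  define c where "c = \<i> * complex_of_real (s + t)"
  have s: "s > 0" using z by (simp add: s_def)
  have t: "t > 0" using s by (simp add: t_def add_nonneg_pos)
  have sh: "star h = h"
    using P by (simp add: h_def star_diff star_scaleC selfadjoint_def)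
  have sw: "star w = h + scaleC (- (\<i> * of_real t)) 1"
    by (simp add: w_def star_add star_scaleC sh)
  \<comment> \<open>The terms linear in h cancel: \<open>star\<close> changes the sign of i t, and
    scalars are central.\<close>
  have "star w * w = h * h + scaleC (of_real (t\<^sup>2)) 1"
    unfolding sw unfolding w_def
    by (simp add: algebra_simps mult_scaleC_left mult_scaleC_right scaleC_scaleC
        scaleC_diff_right power2_eq_square del: of_real_power)
  then have "(norm w)\<^sup>2 = norm (h * h + scaleC (of_real (t\<^sup>2)) 1)"
    using cstar_identity[of w] by simp
  also have "\<dots> \<le> norm (h * h) + norm (scaleC (of_real (t\<^sup>2)) (1::'a))"
    by (rule norm_triangle_ineq)
  also have "\<dots> = (norm h)\<^sup>2 + t\<^sup>2"
    using cstar_identity[of h] by (simp add: sh norm_scaleC norm_power)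
  also have "\<dots> < (s + t)\<^sup>2"
  proof -
    have "s * t = (norm h)\<^sup>2 + 1" using s by (simp add: t_def)
    moreover have "(s + t)\<^sup>2 = s\<^sup>2 + 2 * (s * t) + t\<^sup>2"
      by (simp add: power2_eq_square algebra_simps)
    ultimately show ?thesis using zero_le_power2[of s] zero_le_power2[of "norm h"] by linarith
  qed
  finally have "norm w < s + t"
    using s t by (auto dest: power_less_imp_less_base)
  moreover have "cmod c = s + t"
    using s t unfolding c_def norm_mult norm_of_real by simp
  moreover have "norm (scaleC (inverse c) w) = norm w / cmod c"
    by (simp add: norm_scaleC norm_inverse divide_inverse mult.commute)
  ultimately have small: "norm (scaleC (inverse c) w) < 1"
    using s t by simp
  have c0: "c \<noteq> 0" using s t by (simp add: c_def flip: of_real_add)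
  have "scalar_elem z - P = scaleC c 1 - w"
  proof -
    have "z = of_real (Re z) + \<i> * of_real s" by (simp add: s_def complex_eq)
    then have "scalar_elem z = scaleC (of_real (Re z)) (1::'a) + scaleC (\<i> * of_real s) 1"
      unfolding scalar_elem_def by (metis scaleC_add_left)
    then show ?thesis
      by (simp add: w_def h_def c_def distrib_left scaleC_add_left)
  qed
  also have "\<dots> = scaleC c (1 - scaleC (inverse c) w)"
    using c0 scaleC_add_right[of c 1 "- scaleC (inverse c) w"]
      scaleC_scaleC[of c "- inverse c" w]
    by simp
  finally have eq: "scalar_elem z - P = scaleC c (1 - scaleC (inverse c) w)" .
  have "is_inv (scalar_elem z - P) (scaleC (inverse c) (neumann (scaleC (inverse c) w)))"
    using is_inv_neumann[OF small] c0 unfolding eq is_inv_def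
    by (simp add: mult_scaleC_left mult_scaleC_right scaleC_scaleC)
  then show ?thesis ..
qed

text \<open>The square root is the binomial series \<open>(1 - h)\<^bsup>1/2\<^esup>\<close>.\<close>

lemma one_minus_selfadjoint_eq_square:
  fixes h :: "'a::cstar_algebra"
  assumes h: "selfadjoint h" "norm h < 1"
  obtains y where "star y * y = 1 - h"
proof
  define a :: "nat \<Rightarrow> real" where "a k = (1 / 2) gchoose k" for k
  define f where "f k = a k *\<^sub>R (- h) ^ k" for k
  \<comment> \<open>The coefficients of (1 + x)^(1/2) have radius of convergence 1 > |h|. Absolute
    convergence is what the Cauchy product below requires.\<close>
  have "summable (\<lambda>k. norm (a k * norm h ^ k))"
    by (rule abs_summable_in_conv_radius)
      (use h in \<open>simp add: a_def[abs_def] conv_radius_gchoose one_ereal_def\<close>)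
  then have nsum: "summable (\<lambda>k. norm (f k))"
  proof (rule summable_comparison_test_ev[rotated])
    show "\<forall>\<^sub>F k in sequentially. norm (norm (f k)) \<le> norm (a k * norm h ^ k)"
      using norm_power_ineq[of "- h"] by (simp add: f_def abs_mult mult_left_mono)
  qed
  have sum: "summable f" using nsum by (rule summable_norm_cancel)
  let ?y = "suminf f"
  \<comment> \<open>Real coefficients and a selfadjoint h make every term fixed by
    \<open>star\<close>, so y* y is the square of y.\<close>
  have "star ?y = suminf (\<lambda>k. star (f k))"
    by (rule bounded_linear.suminf[OF bounded_linear_star sum])
  also have "\<dots> = ?y"
    using h by (simp add: f_def[abs_def] star_scaleR star_power selfadjoint_def)
  finally have "star ?y * ?y = ?y * ?y" by simp
  also have "\<dots> = suminf (\<lambda>k. \<Sum>i\<le>k. f i * f (k - i))"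
    by (rule Cauchy_product[OF nsum nsum])
  also have "\<dots> = suminf (\<lambda>k. (1 gchoose k) *\<^sub>R (- h) ^ k)"
  proof (rule suminf_cong)
    fix k
    have "(\<Sum>i\<le>k. f i * f (k - i)) = (\<Sum>i\<le>k. (a i * a (k - i)) *\<^sub>R (- h) ^ k)"
      by (intro sum.cong) (simp_all add: f_def flip: power_add)
    also have "\<dots> = (\<Sum>i\<le>k. a i * a (k - i)) *\<^sub>R (- h) ^ k"
      by (simp add: scaleR_sum_left)
    \<comment> \<open>Vandermonde's identity is the coefficient form of (1 + x)^(1/2) (1 + x)^(1/2)
      = 1 + x.\<close>
    also have "(\<Sum>i\<le>k. a i * a (k - i)) = 1 gchoose k"
      using gbinomial_Vandermonde[of "1/2 :: real" "1/2" k] by (simp add: a_def atMost_atLeast0)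
    finally show "(\<Sum>i\<le>k. f i * f (k - i)) = (1 gchoose k) *\<^sub>R (- h) ^ k" .
  qed
  also have "\<dots> = (\<Sum>k\<in>{0,1}. (1 gchoose k) *\<^sub>R (- h) ^ k)"
  proof (rule suminf_finite)
    fix k :: nat assume "k \<notin> {0, 1}"
    then have "(1 :: real) gchoose k = 0"
      using binomial_gbinomial[of 1 k, where ?'a = real] by (simp add: binomial_eq_0)
    then show "((1 :: real) gchoose k) *\<^sub>R (- h) ^ k = 0" by simp
  qed simp
  finally show "star ?y * ?y = 1 - h" by simp
qed

section \<open>Boundedness of states\<close>

text \<open>Both 1 - h and 1 + h have the form y* y, so positivity bounds the value of the state
  from both sides and also shows that it is real.\<close>

lemma state_selfadjoint_bound:
  assumes \<phi>: "state \<phi>" and h: "selfadjoint h" "norm h < 1"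
  shows "cmod (\<phi> h) \<le> 1"
proof -
  have add: "\<phi> (x + y) = \<phi> x + \<phi> y" for x y using \<phi> by (simp add: state_def)
  have sc: "\<phi> (scaleC c x) = c * \<phi> x" for c x using \<phi> by (simp add: state_def)
  have minus: "\<phi> (- x) = - \<phi> x" for x using sc[of "-1" x] by simp
  have *: "\<phi> g \<in> \<real>" "Re (\<phi> g) \<le> 1" if g: "selfadjoint g" "norm g < 1" for g
  proof -
    obtain y where y: "star y * y = 1 - g" by (rule one_minus_selfadjoint_eq_square[OF g])
    have "\<phi> (1 - g) \<in> \<real>" "Re (\<phi> (1 - g)) \<ge> 0"
      using \<phi> unfolding y[symmetric] state_def by blast+
    moreover have "\<phi> (1 - g) = 1 - \<phi> g"
      using add[of 1 "- g"] minus[of g] \<phi> by (simp add: state_def)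
    ultimately show "\<phi> g \<in> \<real>" "Re (\<phi> g) \<le> 1"
      by (auto simp: complex_is_Real_iff)
  qed
  have "\<bar>Re (\<phi> h)\<bar> \<le> 1"
    using *(2)[OF h] *(2)[of "- h"] h by (simp add: minus selfadjoint_def)
  then show ?thesis using *(1)[OF h] by (simp add: in_Reals_norm)
qed

text \<open>Split x = u + i v with u, v selfadjoint of norm at most |x|. This gives the bound 2 on
  the open unit ball, and rescaling turns it into the constant 4. The constant is crude, but only
  continuity is wanted.\<close>

lemma bounded_linear_state:
  assumes \<phi>: "state \<phi>"
  shows "bounded_linear \<phi>"
proof (rule bounded_linear_intro[where K = 4])
  have add: "\<phi> (x + y) = \<phi> x + \<phi> y" for x y using \<phi> by (simp add: state_def)
  have sc: "\<phi> (scaleC c x) = c * \<phi> x" for c x using \<phi> by (simp add: state_def)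
  show "\<phi> (x + y) = \<phi> x + \<phi> y" for x y by (rule add)
  show scR: "\<phi> (r *\<^sub>R x) = r *\<^sub>R \<phi> x" for r x
    using sc[of "of_real r" x] by (simp add: scaleC_of_real scaleR_conv_of_real)
  have small: "cmod (\<phi> x) \<le> 2" if x: "norm x < 1" for x
  proof -
    define u where "u = (1 / 2) *\<^sub>R (x + star x)"
    define v where "v = scaleC (- \<i> / 2) (x - star x)"
    have "norm u \<le> norm x" using norm_triangle_ineq[of x "star x"] by (simp add: u_def)
    moreover have "norm v \<le> norm x"
      using norm_triangle_ineq4[of x "star x"] by (simp add: v_def norm_scaleC norm_divide)
    moreover have "selfadjoint u"
      by (simp add: u_def selfadjoint_def star_scaleR star_add star_star add.commute)
    moreover have "selfadjoint v"
    proof -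
      have "star v = scaleC (\<i> / 2) (- (x - star x))"
        by (simp add: v_def star_scaleC star_diff star_star)
      also have "\<dots> = v"
        unfolding v_def using scaleC_scaleC[of "\<i> / 2" "-1" "x - star x"] by simp
      finally show ?thesis by (simp add: selfadjoint_def)
    qed
    ultimately have "cmod (\<phi> u) \<le> 1" "cmod (\<phi> v) \<le> 1"
      using x by (auto intro!: state_selfadjoint_bound[OF \<phi>])
    moreover have "x = u + scaleC \<i> v"
    proof -
      have "scaleC \<i> v = (1 / 2) *\<^sub>R (x - star x)"
        using scaleC_of_real[of "1/2" "x - star x"]
          scaleC_scaleC[of \<i> "- \<i> / 2" "x - star x"]
        by (simp add: v_def)
      then show ?thesis by (simp add: u_def scaleR_add_right scaleR_diff_right flip: scaleR_add_left)
    qed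
    then have "\<phi> x = \<phi> u + \<i> * \<phi> v" using add sc by metis
    ultimately show ?thesis using norm_triangle_ineq[of "\<phi> u" "\<i> * \<phi> v"]
      by (simp add: norm_mult)
  qed
  show "norm (\<phi> x) \<le> norm x * 4" for x
  proof (cases "x = 0")
    case True
    then show ?thesis using scR[of 0 0] by simp
  next
    case False
    \<comment> \<open>The factor r brings x to norm 1/2, strictly inside the ball where
      \<open>small\<close> applies.\<close>
    define r where "r = 1 / (2 * norm x)"
    have r: "r > 0" using False by (simp add: r_def)
    have "norm (r *\<^sub>R x) < 1" using False by (simp add: r_def)
    from small[OF this] have "r * cmod (\<phi> x) \<le> 2" using r by (simp add: scR)
    then show ?thesis using False by (simp add: r_def field_simps)
  qed
qed


section \<open>Evaluation of polynomials\<close>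

lemma poly_mapping_eq_sum_single:
  fixes p :: "'b \<Rightarrow>\<^sub>0 'c::comm_monoid_add"
  shows "p = (\<Sum>w\<in>Poly_Mapping.keys p. Poly_Mapping.single w (Poly_Mapping.lookup p w))"
  by (rule poly_mapping_eqI)
    (auto simp: lookup_sum lookup_single when_def in_keys_iff)

text \<open>Expanding both factors reduces this to monomials, where words are concatenated and the
  complex coefficients can be pulled out of the product.\<close>

lemma nc_eval_mult: "nc_eval X (p * q) = nc_eval X p * nc_eval X q"
proof -
  let ?s = "\<lambda>p w. Poly_Mapping.single w (Poly_Mapping.lookup p w)"
  let ?m = "\<lambda>w. prod_list (map X (letters w))"
  have "p * q = (\<Sum>v\<in>Poly_Mapping.keys p. \<Sum>w\<in>Poly_Mapping.keys q. ?s p v * ?s q w)"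
    by (subst (1) poly_mapping_eq_sum_single[of p], subst (1) poly_mapping_eq_sum_single[of q])
      (simp add: sum_product)
  then have "nc_eval X (p * q) =
      (\<Sum>v\<in>Poly_Mapping.keys p. \<Sum>w\<in>Poly_Mapping.keys q.
        scaleC (Poly_Mapping.lookup p v) (?m v) * scaleC (Poly_Mapping.lookup q w) (?m w))"
    by (simp add: nc_eval_sum mult_single nc_eval_single plus_ncmonom_def
        mult_scaleC_left mult_scaleC_right scaleC_scaleC mult.commute)
  then show ?thesis by (simp add: nc_eval_def sum_product)
qed

lemma nc_eval_one [simp]: "nc_eval X 1 = 1"
  using nc_eval_single[of X 0 1] unfolding single_one by (simp add: zero_ncmonom_def)

lemma nc_eval_zero [simp]: "nc_eval X 0 = 0"
  by (simp add: nc_eval_def)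

lemma nc_eval_minus: "nc_eval X (- p) = - nc_eval X p"
  using nc_eval_add[of X p "- p"] by (simp add: eq_neg_iff_add_eq_0 add.commute)

lemma star_prod_list_selfadjoint:
  assumes "\<And>i. selfadjoint (X i)"
  shows "star (prod_list (map X w)) = prod_list (map X (rev w))"
  using assms by (induction w) (simp_all add: star_mult selfadjoint_def)

text \<open>Reversal is an involution on words, so the sum can be reindexed along it; the star of a
  product of selfadjoint elements is the product in reverse order.\<close>

lemma nc_eval_star:
  assumes "\<And>i. selfadjoint (X i)"
  shows "nc_eval X (nc_star p) = star (nc_eval X p)"
proof -
  have keys: "Poly_Mapping.keys (nc_star p) = monom_rev ` Poly_Mapping.keys p"
  proof (rule equalityI; rule subsetI)
    fix w assume "w \<in> Poly_Mapping.keys (nc_star p)"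
    then have "monom_rev w \<in> Poly_Mapping.keys p" by (simp add: in_keys_iff nc_star.rep_eq)
    then show "w \<in> monom_rev ` Poly_Mapping.keys p" by (metis imageI monom_rev_rev)
  qed (auto simp: in_keys_iff nc_star.rep_eq)
  have inj: "inj_on monom_rev A" for A :: "'a ncmonom set"
    by (metis inj_onI monom_rev_rev)
  have "nc_eval X (nc_star p) = (\<Sum>w\<in>Poly_Mapping.keys p.
      scaleC (cnj (Poly_Mapping.lookup p w)) (prod_list (map X (rev (letters w)))))"
    by (simp add: nc_eval_def keys sum.reindex[OF inj] nc_star.rep_eq)
      (simp add: monom_rev_def)
  then show ?thesis
    by (simp add: nc_eval_def star_sum star_scaleC star_prod_list_selfadjoint[OF assms])
qed


section \<open>Block matrices\<close>

text \<open>Unlike \<open>inverts_mat\<close>, this fixes the shape of both matrices, as the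
  associativity and distributivity laws for matrices demand.\<close>

definition is_mat_inv :: "nat \<Rightarrow> 'a::ring_1 mat \<Rightarrow> 'a mat \<Rightarrow> bool" where
  "is_mat_inv n A B \<longleftrightarrow>
     A \<in> carrier_mat n n \<and> B \<in> carrier_mat n n \<and> A * B = 1\<^sub>m n \<and> B * A = 1\<^sub>m n"

lemma is_mat_inv_imp:
  assumes "is_mat_inv n A B"
  shows "invertible_mat A" "mat_inv A = B"
proof -
  have A: "A \<in> carrier_mat n n" and inv: "inverts_mat A B" "inverts_mat B A"
    using assms by (auto simp: is_mat_inv_def inverts_mat_def)
  show "mat_inv A = B" by (rule mat_inv_eqI[OF A inv])
  show "invertible_mat A" using A inv by (auto simp: invertible_mat_def)
qed

lemma is_mat_inv_mat_inv:
  assumes A: "A \<in> carrier_mat n n" and inv: "invertible_mat A"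
  shows "is_mat_inv n A (mat_inv A)"
proof -
  obtain B where B: "inverts_mat A B" "inverts_mat B A"
    using inv by (auto simp: invertible_mat_def)
  have AB: "A * B = 1\<^sub>m n" using B A by (simp add: inverts_mat_def)
  have BA: "B * A = 1\<^sub>m (dim_row B)" using B by (simp add: inverts_mat_def)
  \<comment> \<open>The shape of B is not part of \<open>invertible_mat\<close>; it is read off by
    counting columns in A B = 1 and B A = 1.\<close>
  have "dim_col B = n" using arg_cong[OF AB, of dim_col] by simp
  moreover have "dim_row B = n" using arg_cong[OF BA, of dim_col] A by simp
  ultimately have "is_mat_inv n A B" using A AB BA by (auto simp: is_mat_inv_def)
  with is_mat_inv_imp(2) show ?thesis by metis
qed

lemma is_mat_inv_uminus:
  fixes A :: "'a::ring_1 mat"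
  assumes "is_mat_inv n A B"
  shows "is_mat_inv n (- A) (- B)"
proof -
  have A: "A \<in> carrier_mat n n" and B: "B \<in> carrier_mat n n"
    using assms by (auto simp: is_mat_inv_def)
  have "- A * - B = A * B" "- B * - A = B * A"
    using carrier_matD[OF A] carrier_matD[OF B] by simp_all
  then show ?thesis using assms by (simp add: is_mat_inv_def)
qed

text \<open>Lets an inverse in the algebra serve as the inverse of a 1 x 1 Schur complement.\<close>

lemma is_mat_inv_one_block:
  fixes x y :: "'a::ring_1"
  shows "is_mat_inv 1 (mat 1 1 (\<lambda>_. x)) (mat 1 1 (\<lambda>_. y)) \<longleftrightarrow> is_inv x y"
proof -
  have "mat 1 1 (\<lambda>_. x) * mat 1 1 (\<lambda>_. y) = mat 1 1 (\<lambda>_. x * y)" for x y :: 'a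
    by (intro eq_matI) (auto simp: scalar_prod_def)
  moreover have "mat 1 1 (\<lambda>_. x) = 1\<^sub>m 1 \<longleftrightarrow> x = 1" for x :: 'a
    by (auto simp: mat_eq_iff)
  ultimately show ?thesis by (simp add: is_mat_inv_def is_inv_def)
qed

text \<open>Block inversion through the Schur complement of D. The entries need not commute, so both
  products are checked block by block. The upper left block of the inverse is S' itself, which is
  what the theorem reads off.\<close>

lemma is_mat_inv_four_block:
  fixes A :: "'a::ring_1 mat"
  assumes A: "A \<in> carrier_mat m m" and B: "B \<in> carrier_mat m k" and C: "C \<in> carrier_mat k m"
    and D: "is_mat_inv k D D'" and S: "is_mat_inv m (A - B * D' * C) S'"
  shows "is_mat_inv (m + k) (four_block_mat A B C D)
    (four_block_mat S' (- (S' * (B * D'))) (- (D' * C * S')) (D' + D' * C * S' * (B * D')))"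
proof -
  define X where "X = B * D'"
  define Y where "Y = D' * C"
  define S where "S = A - B * D' * C"
  have D1: "D \<in> carrier_mat k k" "D' \<in> carrier_mat k k" "D * D' = 1\<^sub>m k" "D' * D = 1\<^sub>m k"
    using D by (auto simp: is_mat_inv_def)
  have S1: "S \<in> carrier_mat m m" "S' \<in> carrier_mat m m" "S * S' = 1\<^sub>m m" "S' * S = 1\<^sub>m m"
    using assms(5) by (auto simp: is_mat_inv_def S_def)
  have X: "X \<in> carrier_mat m k" and Y: "Y \<in> carrier_mat k m"
    using B C D1 by (auto simp: X_def Y_def)
  note car = A B C D1(1,2) S1(1,2) X Y
  have XD: "X * D = B"
    using B D1 assoc_mult_mat[OF B D1(2) D1(1)] by (simp add: X_def)
  have DY: "D * Y = C"
    using C D1 assoc_mult_mat[OF D1(1) D1(2) C] by (simp add: Y_def)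
  have XC: "X * C \<in> carrier_mat m m" and BY: "B * Y = X * C"
    using B C D1 X assoc_mult_mat[OF B D1(2) C] by (auto simp: X_def Y_def)
  \<comment> \<open>A enters the block products only in this form, which splits off S so that it
    cancels against S'.\<close>
  have A_eq: "A = S + X * C"
    using A XC by (intro eq_matI) (auto simp: S_def X_def[symmetric])
  let ?P = "S' * X" and ?Q = "Y * S'"
  have P: "?P \<in> carrier_mat m k" and Q: "?Q \<in> carrier_mat k m" and QX: "?Q * X \<in> carrier_mat k k"
    using X Y S1 by auto
  have SP: "S * ?P = X" using assoc_mult_mat[OF S1(1) S1(2) X] S1 X by simp
  have QS: "?Q * S = Y" using assoc_mult_mat[OF Y S1(2) S1(1)] S1 Y by simp
  have BQ: "B * ?Q = X * C * S'" using assoc_mult_mat[OF B Y S1(2)] BY by simp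
  have DQ: "D * ?Q = C * S'" using assoc_mult_mat[OF D1(1) Y S1(2)] DY by simp
  have PD: "?P * D = S' * B" using assoc_mult_mat[OF S1(2) X D1(1)] XD by simp
  have QXD: "?Q * X * D = ?Q * B" using assoc_mult_mat[OF Q X D1(1)] XD by simp
  have PC: "?P * C = S' * (X * C)" using assoc_mult_mat[OF S1(2) X C] by simp
  have QXC: "?Q * X * C = ?Q * (X * C)" using assoc_mult_mat[OF Q X C] by simp
  let ?N = "four_block_mat S' (- ?P) (- ?Q) (D' + ?Q * X)"
  let ?M = "four_block_mat A B C D"
  have carN: "?N \<in> carrier_mat (m + k) (m + k)" and carM: "?M \<in> carrier_mat (m + k) (m + k)"
    using car P Q QX by auto
  \<comment> \<open>Right inverse: the four blocks of the product are computed in turn.\<close>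
  have "?M * ?N = four_block_mat (A * S' + B * (- ?Q)) (A * (- ?P) + B * (D' + ?Q * X))
      (C * S' + D * (- ?Q)) (C * (- ?P) + D * (D' + ?Q * X))"
    by (rule mult_four_block_mat) (use car P Q QX in auto)
  moreover have "A * S' + B * (- ?Q) = 1\<^sub>m m"
  proof -
    have "A * S' = 1\<^sub>m m + X * C * S'"
      unfolding A_eq add_mult_distrib_mat[OF S1(1) XC S1(2)] S1(3) ..
    moreover have "B * (- ?Q) = - (X * C * S')" using carrier_matD[OF B] carrier_matD[OF Q] BQ
      by (subst uminus_mult_right_mat) simp_all
    ultimately show ?thesis using XC S1(2) by (intro eq_matI) auto
  qed
  moreover have "A * (- ?P) + B * (D' + ?Q * X) = 0\<^sub>m m k"
  proof -
    have "A * ?P = X + X * C * ?P"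
      unfolding A_eq add_mult_distrib_mat[OF S1(1) XC P] SP ..
    moreover have "X * C * ?P = X * C * S' * X" using assoc_mult_mat[OF XC S1(2) X] by simp
    moreover have "B * (?Q * X) = X * C * S' * X" using assoc_mult_mat[OF B Q X] BQ by simp
    moreover have "A * (- ?P) = - (A * ?P)"
      using carrier_matD[OF A] carrier_matD[OF P] by (subst uminus_mult_right_mat) simp_all
    moreover have "B * (D' + ?Q * X) = X + B * (?Q * X)"
      using mult_add_distrib_mat[OF B D1(2) QX] by (simp add: X_def)
    moreover have "X * C * S' * X \<in> carrier_mat m k" using XC S1(2) X by auto
    ultimately show ?thesis using X by (intro eq_matI) auto
  qed
  moreover have "C * S' + D * (- ?Q) = 0\<^sub>m k m"
  proof -
    have "D * (- ?Q) = - (C * S')"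
      using carrier_matD[OF D1(1)] carrier_matD[OF Q] DQ by (subst uminus_mult_right_mat) simp_all
    then show ?thesis using carrier_matD[OF C] carrier_matD[OF S1(2)] by (intro eq_matI) auto
  qed
  moreover have "C * (- ?P) + D * (D' + ?Q * X) = 1\<^sub>m k"
  proof -
    have "D * (D' + ?Q * X) = 1\<^sub>m k + D * (?Q * X)"
      using mult_add_distrib_mat[OF D1(1,2) QX] D1(3) by simp
    moreover have "D * (?Q * X) = C * S' * X" using assoc_mult_mat[OF D1(1) Q X] DQ by simp
    moreover have "C * ?P = C * S' * X" using assoc_mult_mat[OF C S1(2) X] by simp
    moreover have "C * (- ?P) = - (C * ?P)"
      using carrier_matD[OF C] carrier_matD[OF P] by (subst uminus_mult_right_mat) simp_all
    ultimately show ?thesis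
      using carrier_matD[OF C] carrier_matD[OF X] by (intro eq_matI) auto
  qed
  ultimately have MN: "?M * ?N = 1\<^sub>m (m + k)" by simp
  \<comment> \<open>Left inverse, by the mirror-image computation.\<close>
  have "?N * ?M = four_block_mat (S' * A + (- ?P) * C) (S' * B + (- ?P) * D)
      ((- ?Q) * A + (D' + ?Q * X) * C) ((- ?Q) * B + (D' + ?Q * X) * D)"
    by (rule mult_four_block_mat) (use car P Q QX in auto)
  moreover have "S' * A + (- ?P) * C = 1\<^sub>m m"
  proof -
    have "S' * A = 1\<^sub>m m + S' * (X * C)"
      unfolding A_eq mult_add_distrib_mat[OF S1(2) S1(1) XC] S1(4) ..
    moreover have "(- ?P) * C = - (S' * (X * C))"
      using carrier_matD[OF C] carrier_matD[OF P] PC by (subst uminus_mult_left_mat) simp_all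
    ultimately show ?thesis using XC S1(2) by (intro eq_matI) auto
  qed
  moreover have "S' * B + (- ?P) * D = 0\<^sub>m m k"
  proof -
    have "(- ?P) * D = - (S' * B)"
      using carrier_matD[OF D1(1)] carrier_matD[OF P] PD by (subst uminus_mult_left_mat) simp_all
    then show ?thesis using carrier_matD[OF B] carrier_matD[OF S1(2)] by (intro eq_matI) auto
  qed
  moreover have "(- ?Q) * A + (D' + ?Q * X) * C = 0\<^sub>m k m"
  proof -
    have "?Q * A = Y + ?Q * (X * C)"
      unfolding A_eq mult_add_distrib_mat[OF Q S1(1) XC] QS ..
    moreover have "(- ?Q) * A = - (?Q * A)"
      using carrier_matD[OF A] carrier_matD[OF Q] by (subst uminus_mult_left_mat) simp_all
    moreover have "(D' + ?Q * X) * C = Y + ?Q * (X * C)"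
      using add_mult_distrib_mat[OF D1(2) QX C] QXC by (simp add: Y_def)
    moreover have "?Q * (X * C) \<in> carrier_mat k m" using XC Q by auto
    ultimately show ?thesis using Y by (intro eq_matI) auto
  qed
  moreover have "(- ?Q) * B + (D' + ?Q * X) * D = 1\<^sub>m k"
  proof -
    have "(D' + ?Q * X) * D = 1\<^sub>m k + ?Q * B"
      using add_mult_distrib_mat[OF D1(2) QX D1(1)] QXD D1(4) by simp
    moreover have "(- ?Q) * B = - (?Q * B)"
      using carrier_matD[OF B] carrier_matD[OF Q] by (subst uminus_mult_left_mat) simp_all
    ultimately show ?thesis
      using carrier_matD[OF B] carrier_matD[OF Y] by (intro eq_matI) auto
  qed
  ultimately have NM: "?N * ?M = 1\<^sub>m (m + k)" by simp
  show ?thesis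
    using MN NM carN carM by (simp add: is_mat_inv_def X_def Y_def)
qed


section \<open>Continuity of matrix inversion\<close>

text \<open>Convergence is entrywise, so no norm on matrices over the algebra has to be chosen. The
  shape is imposed for every e, not just eventually, so that entries of sums, products and blocks
  can be expanded freely.\<close>

definition mat_tendsto ::
    "('b \<Rightarrow> 'a::real_normed_algebra_1 mat) \<Rightarrow> 'a mat \<Rightarrow> nat \<Rightarrow> nat \<Rightarrow> 'b filter \<Rightarrow> bool" where
  "mat_tendsto A L m k F \<longleftrightarrow> (\<forall>e. A e \<in> carrier_mat m k) \<and> L \<in> carrier_mat m k \<and>
     (\<forall>i<m. \<forall>j<k. ((\<lambda>e. A e $$ (i, j)) \<longlongrightarrow> L $$ (i, j)) F)"

lemma mat_tendsto_const: "L \<in> carrier_mat m k \<Longrightarrow> mat_tendsto (\<lambda>_. L) L m k F"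
  by (simp add: mat_tendsto_def)

lemma mat_tendstoD:
  assumes "mat_tendsto A L m k F"
  shows "dim_row (A e) = m" "dim_col (A e) = k" "dim_row L = m" "dim_col L = k"
    and "i < m \<Longrightarrow> j < k \<Longrightarrow> ((\<lambda>e. A e $$ (i, j)) \<longlongrightarrow> L $$ (i, j)) F"
  using assms unfolding mat_tendsto_def by blast+

lemma mat_tendstoI:
  assumes "\<And>e. dim_row (A e) = m" "\<And>e. dim_col (A e) = k" "dim_row L = m" "dim_col L = k"
    and "\<And>i j. i < m \<Longrightarrow> j < k \<Longrightarrow> ((\<lambda>e. A e $$ (i, j)) \<longlongrightarrow> L $$ (i, j)) F"
  shows "mat_tendsto A L m k F"
  using assms unfolding mat_tendsto_def by blast

lemma mat_tendsto_add:
  assumes A: "mat_tendsto A L m k F" and B: "mat_tendsto B M m k F"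
  shows "mat_tendsto (\<lambda>e. A e + B e) (L + M) m k F"
  using tendsto_add[OF mat_tendstoD(5)[OF A] mat_tendstoD(5)[OF B]]
  by (intro mat_tendstoI) (simp_all add: mat_tendstoD(1-4)[OF A] mat_tendstoD(1-4)[OF B])

lemma mat_tendsto_uminus:
  assumes A: "mat_tendsto A L m k F"
  shows "mat_tendsto (\<lambda>e. - A e) (- L) m k F"
  using tendsto_minus[OF mat_tendstoD(5)[OF A]]
  by (intro mat_tendstoI) (simp_all add: mat_tendstoD(1-4)[OF A])

lemma mat_tendsto_minus:
  assumes A: "mat_tendsto A L m k F" and B: "mat_tendsto B M m k F"
  shows "mat_tendsto (\<lambda>e. A e - B e) (L - M) m k F"
  using tendsto_diff[OF mat_tendstoD(5)[OF A] mat_tendstoD(5)[OF B]]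
  by (intro mat_tendstoI) (simp_all add: mat_tendstoD(1-4)[OF A] mat_tendstoD(1-4)[OF B])

lemma mat_tendsto_mult:
  assumes A: "mat_tendsto A L m k F" and B: "mat_tendsto B M k l F"
  shows "mat_tendsto (\<lambda>e. A e * B e) (L * M) m l F"
proof (rule mat_tendstoI)
  fix i j assume ij: "i < m" "j < l"
  have "((\<lambda>e. \<Sum>r\<in>{0..<k}. A e $$ (i, r) * B e $$ (r, j))
      \<longlongrightarrow> (\<Sum>r\<in>{0..<k}. L $$ (i, r) * M $$ (r, j))) F"
    using ij by (intro tendsto_sum tendsto_mult mat_tendstoD(5)[OF A] mat_tendstoD(5)[OF B]) auto
  then show "((\<lambda>e. (A e * B e) $$ (i, j)) \<longlongrightarrow> (L * M) $$ (i, j)) F"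
    using ij by (simp add: mat_tendstoD(1-4)[OF A] mat_tendstoD(1-4)[OF B] scalar_prod_def)
qed (simp_all add: mat_tendstoD(1-4)[OF A] mat_tendstoD(1-4)[OF B])

lemma mat_tendsto_four_block:
  assumes A: "mat_tendsto A A' m m F" and B: "mat_tendsto B B' m k F"
    and C: "mat_tendsto C C' k m F" and D: "mat_tendsto D D' k k F"
  shows "mat_tendsto (\<lambda>e. four_block_mat (A e) (B e) (C e) (D e)) (four_block_mat A' B' C' D')
    (m + k) (m + k) F"
proof (rule mat_tendstoI)
  note dims = mat_tendstoD(1-4)[OF A] mat_tendstoD(1-4)[OF D]
  show "((\<lambda>e. four_block_mat (A e) (B e) (C e) (D e) $$ (i, j))
      \<longlongrightarrow> four_block_mat A' B' C' D' $$ (i, j)) F" if "i < m + k" "j < m + k" for i j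
  proof -
    have "i < m \<or> i - m < k" "j < m \<or> j - m < k" using that by auto
    then show ?thesis
      using that mat_tendstoD(5)[OF A, of i j] mat_tendstoD(5)[OF B, of i "j - m"]
        mat_tendstoD(5)[OF C, of "i - m" j] mat_tendstoD(5)[OF D, of "i - m" "j - m"]
      by (cases "i < m"; cases "j < m") (simp_all add: dims)
  qed
qed (simp_all add: mat_tendstoD(1-4)[OF A] mat_tendstoD(1-4)[OF D])

text \<open>Induction on the size, splitting off the first row and column. The off-diagonal blocks
  tend to 0, so the Schur complement tends to 1 and the scalar Neumann series inverts it; the block
  formula then assembles the inverse.\<close>

lemma mat_tendsto_inverse_one:
  fixes A :: "'b \<Rightarrow> 'a::{real_normed_algebra_1,banach} mat"
  assumes "mat_tendsto A (1\<^sub>m n) n n F"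
  shows "\<exists>B. mat_tendsto B (1\<^sub>m n) n n F \<and> (\<forall>\<^sub>F e in F. is_mat_inv n (A e) (B e))"
  using assms
proof (induction n arbitrary: A)
  case 0
  have "is_mat_inv 0 (A e) (A e)" for e
    using mat_tendstoD(1,2)[OF 0, of e] by (auto simp: is_mat_inv_def)
  with 0 show ?case by auto
next
  case (Suc k)
  have car: "A e \<in> carrier_mat (Suc k) (Suc k)" for e
    using Suc.prems by (simp add: mat_tendsto_def)
  have lim: "((\<lambda>e. A e $$ (i, j)) \<longlongrightarrow> (1\<^sub>m (Suc k) :: 'a mat) $$ (i, j)) F"
    if "i < Suc k" "j < Suc k" for i j
    using Suc.prems that by (simp add: mat_tendsto_def)
  define a where "a e = mat 1 1 (\<lambda>_. A e $$ (0, 0))" for e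
  define b where "b e = mat 1 k (\<lambda>(i, j). A e $$ (0, Suc j))" for e
  define c where "c e = mat k 1 (\<lambda>(i, j). A e $$ (Suc i, 0))" for e
  define d where "d e = mat k k (\<lambda>(i, j). A e $$ (Suc i, Suc j))" for e
  have A_eq: "A e = four_block_mat (a e) (b e) (c e) (d e)" for e
    using carrier_matD[OF car[of e]]
    by (intro eq_matI) (auto simp: a_def b_def c_def d_def)
  have a: "mat_tendsto a (1\<^sub>m 1) 1 1 F"
    using lim[of 0 0] by (simp add: mat_tendsto_def a_def)
  have b: "mat_tendsto b (0\<^sub>m 1 k) 1 k F"
    using lim[of 0 "Suc j" for j] by (simp add: mat_tendsto_def b_def)
  have c: "mat_tendsto c (0\<^sub>m k 1) k 1 F"
    using lim[of "Suc j" 0 for j] by (simp add: mat_tendsto_def c_def)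
  have d: "mat_tendsto d (1\<^sub>m k) k k F"
    using lim[of "Suc i" "Suc j" for i j] by (simp add: mat_tendsto_def d_def)
  obtain D' where D': "mat_tendsto D' (1\<^sub>m k) k k F"
    and D'_inv: "\<forall>\<^sub>F e in F. is_mat_inv k (d e) (D' e)"
    using Suc.IH[OF d] by blast
  define S where "S e = a e - b e * D' e * c e" for e
  have "mat_tendsto S (1\<^sub>m 1 - 0\<^sub>m 1 k * 1\<^sub>m k * 0\<^sub>m k 1) 1 1 F"
    unfolding S_def by (intro mat_tendsto_minus a mat_tendsto_mult[OF mat_tendsto_mult[OF b D'] c])
  moreover have "1\<^sub>m 1 - 0\<^sub>m 1 k * 1\<^sub>m k * 0\<^sub>m k 1 = (1\<^sub>m 1 :: 'a mat)"
    by (intro eq_matI) auto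
  ultimately have S: "mat_tendsto S (1\<^sub>m 1) 1 1 F" by simp
  then have "((\<lambda>e. S e $$ (0, 0)) \<longlongrightarrow> 1) F" by (simp add: mat_tendsto_def)
  then obtain g where g: "\<forall>\<^sub>F e in F. is_inv (S e $$ (0, 0)) (g e)" "(g \<longlongrightarrow> 1) F"
    by (rule tendsto_ring_inverse_one)
  define S' where "S' e = mat 1 1 (\<lambda>_. g e)" for e
  have S': "mat_tendsto S' (1\<^sub>m 1) 1 1 F" using g(2) by (simp add: mat_tendsto_def S'_def)
  have S_eq: "S e = mat 1 1 (\<lambda>_. S e $$ (0, 0))" for e
  proof -
    have "S e \<in> carrier_mat 1 1" using S by (simp add: mat_tendsto_def)
    then show ?thesis by (intro eq_matI) auto
  qed
  note bD = mat_tendsto_mult[OF b D'] and cS = mat_tendsto_mult[OF mat_tendsto_mult[OF D' c] S']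
  define N where "N e = four_block_mat (S' e) (- (S' e * (b e * D' e))) (- (D' e * c e * S' e))
    (D' e + D' e * c e * S' e * (b e * D' e))" for e
  \<comment> \<open>The candidate is built from convergent blocks by sums and products, so its limit
    is the same formula evaluated at the limits of the blocks.\<close>
  have "mat_tendsto N (four_block_mat (1\<^sub>m 1) (- (1\<^sub>m 1 * (0\<^sub>m 1 k * 1\<^sub>m k)))
      (- (1\<^sub>m k * 0\<^sub>m k 1 * 1\<^sub>m 1)) (1\<^sub>m k + 1\<^sub>m k * 0\<^sub>m k 1 * 1\<^sub>m 1 * (0\<^sub>m 1 k * 1\<^sub>m k)))
      (1 + k) (1 + k) F"
    unfolding N_def
    by (intro mat_tendsto_four_block mat_tendsto_add mat_tendsto_uminus S' D' bD cS
        mat_tendsto_mult[OF S' bD] mat_tendsto_mult[OF cS bD])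
  moreover have "four_block_mat (1\<^sub>m 1) (- (1\<^sub>m 1 * (0\<^sub>m 1 k * 1\<^sub>m k)))
      (- (1\<^sub>m k * 0\<^sub>m k 1 * 1\<^sub>m 1)) (1\<^sub>m k + 1\<^sub>m k * 0\<^sub>m k 1 * 1\<^sub>m 1 * (0\<^sub>m 1 k * 1\<^sub>m k))
      = (1\<^sub>m (Suc k) :: 'a mat)"
    by (intro eq_matI) auto
  ultimately have N: "mat_tendsto N (1\<^sub>m (Suc k)) (Suc k) (Suc k) F" by simp
  moreover have "\<forall>\<^sub>F e in F. is_mat_inv (Suc k) (A e) (N e)"
    using g(1) D'_inv
  proof eventually_elim
    case (elim e)
    have "is_mat_inv 1 (S e) (S' e)"
      by (subst S_eq) (use elim(1) is_mat_inv_one_block in \<open>auto simp: S'_def\<close>)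
    then have "is_mat_inv (1 + k) (A e) (N e)"
      unfolding A_eq N_def S_def using a b c elim(2)
      by (intro is_mat_inv_four_block) (auto simp: mat_tendsto_def)
    then show ?case by simp
  qed
  ultimately show ?case by blast
qed

text \<open>Multiplying by R, the inverse of the limit, moves the limit to 1. If B inverts R A, then
  B R inverts A, and B R tends to R.\<close>

lemma mat_tendsto_inverse:
  fixes A :: "'b \<Rightarrow> 'a::{real_normed_algebra_1,banach} mat"
  assumes A: "mat_tendsto A L n n F" and L: "is_mat_inv n L R"
  obtains B where "mat_tendsto B R n n F" "\<forall>\<^sub>F e in F. is_mat_inv n (A e) (B e)"
proof -
  have R: "R \<in> carrier_mat n n" "L \<in> carrier_mat n n" and LR: "L * R = 1\<^sub>m n" "R * L = 1\<^sub>m n"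
    using L by (auto simp: is_mat_inv_def)
  have "mat_tendsto (\<lambda>e. R * A e) (R * L) n n F"
    by (rule mat_tendsto_mult[OF mat_tendsto_const[OF R(1)] A])
  then obtain B where B: "mat_tendsto B (1\<^sub>m n) n n F"
      and inv: "\<forall>\<^sub>F e in F. is_mat_inv n (R * A e) (B e)"
    unfolding LR using mat_tendsto_inverse_one by blast
  have "mat_tendsto (\<lambda>e. B e * R) (1\<^sub>m n * R) n n F"
    by (rule mat_tendsto_mult[OF B mat_tendsto_const[OF R(1)]])
  then have "mat_tendsto (\<lambda>e. B e * R) R n n F" using R by simp
  moreover have "\<forall>\<^sub>F e in F. is_mat_inv n (A e) (B e * R)"
    using inv
  proof eventually_elim
    case (elim e)
    have Ae: "A e \<in> carrier_mat n n" using A by (simp add: mat_tendsto_def)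
    have Be: "B e \<in> carrier_mat n n" and RAB: "R * A e * B e = 1\<^sub>m n" and BRA: "B e * (R * A e) = 1\<^sub>m n"
      using elim by (auto simp: is_mat_inv_def)
    \<comment> \<open>Cancelling R in R A B = 1 gives A B = L, which makes B R a right inverse of A
      as well.\<close>
    have AB: "A e * B e = L"
    proof -
      have "A e * B e = L * R * (A e * B e)" using LR Ae Be by simp
      also have "\<dots> = L * (R * A e * B e)"
        using assoc_mult_mat[OF R(2,1), of "A e * B e" n] assoc_mult_mat[OF R(1) Ae Be] Ae Be by simp
      finally show ?thesis using RAB R by simp
    qed
    have "A e * (B e * R) = 1\<^sub>m n"
      using assoc_mult_mat[OF Ae Be R(1)] AB LR by simp
    moreover have "B e * R * A e = 1\<^sub>m n"
      using assoc_mult_mat[OF Be R(1) Ae] BRA by simp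
    ultimately show ?case using Ae Be R by (simp add: is_mat_inv_def)
  qed
  ultimately show ?thesis by (rule that)
qed


section \<open>Linearizations and Cauchy transforms\<close>

lemma map_mat_nc_eval_mult:
  assumes "A \<in> carrier_mat m k" "B \<in> carrier_mat k l"
  shows "map_mat (nc_eval X) (A * B) = map_mat (nc_eval X) A * map_mat (nc_eval X) B"
proof -
  interpret semiring_hom "nc_eval X"
    by unfold_locales (simp_all add: nc_eval_add nc_eval_mult)
  show ?thesis by (rule mat_hom_mult[OF assms])
qed

text \<open>Since q is inverted over the polynomials, evaluation carries the inverse along to the
  algebra for any choice of X.\<close>

lemma is_mat_inv_map_nc_eval:
  assumes "is_mat_inv n A B"
  shows "is_mat_inv n (map_mat (nc_eval X) A) (map_mat (nc_eval X) B)"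
proof -
  have one: "map_mat (nc_eval X) (1\<^sub>m n) = 1\<^sub>m n" by (intro eq_matI) auto
  show ?thesis
    using assms map_mat_nc_eval_mult[of A n n B n X] map_mat_nc_eval_mult[of B n n A n X]
    by (simp add: is_mat_inv_def one)
qed

lemma mat_tendsto_Lambda_mat:
  "mat_tendsto (\<lambda>\<epsilon>. scalar_mat (Lambda_mat n \<epsilon> z) :: 'a::cstar_algebra mat)
     (scalar_mat (Lambda_mat n 0 z)) n n (at_right 0)"
proof -
  have "((\<lambda>\<epsilon>. scalar_elem (\<i> * complex_of_real \<epsilon>) :: 'a) \<longlongrightarrow> scalar_elem 0) (at_right 0)"
  proof -
    have eq: "scalar_elem (\<i> * complex_of_real \<epsilon>) = \<epsilon> *\<^sub>R scalar_elem \<i>" for \<epsilon>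
      by (simp add: scalar_elem_def scaleC_scaleC mult.commute flip: scaleC_of_real)
    show ?thesis unfolding eq by (rule tendsto_eq_intros refl | simp add: scalar_elem_def)+
  qed
  then show ?thesis
    by (auto simp: mat_tendsto_def scalar_mat_def Lambda_mat_def)
qed

theorem theorem8p8:
  fixes \<phi> :: "'a::cstar_algebra \<Rightarrow> complex"
    and X :: "'d::finite \<Rightarrow> 'a"
    and p :: "'d ncpoly" and ph :: "'d ncpoly mat"
    and n :: nat and b0 :: "complex mat" and b :: "'d \<Rightarrow> complex mat"
    and P :: 'a and Ph :: "'a mat" and z :: complex
  assumes "state \<phi>"
    and "\<And>i. selfadjoint (X i)"
    and "nc_star p = p"
    and "b0 \<in> carrier_mat n n" and "\<And>i. b i \<in> carrier_mat n n"
    and "ph = pencil nc_const b0 b nc_var"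
    and "selfadjoint_linearization n ph p"
    and "P = nc_eval X p"
    and "Ph = map_mat (nc_eval X) ph"
    and "Im z > 0"
  shows "invertible_elem (scalar_elem z - P)
    \<and> invertible_mat (scalar_mat (Lambda_mat n 0 z) - Ph)
    \<and> cauchy_transform \<phi> P z = mat_cauchy_transform \<phi> Ph (Lambda_mat n 0 z) $$ (0, 0)
    \<and> (\<forall>\<^sub>F \<epsilon> in at_right 0. invertible_mat (scalar_mat (Lambda_mat n \<epsilon> z) - Ph))
    \<and> ((\<lambda>\<epsilon>. mat_cauchy_transform \<phi> Ph (Lambda_mat n \<epsilon> z) $$ (0, 0))
         \<longlongrightarrow> cauchy_transform \<phi> P z) (at_right 0)"
proof -
  let ?W = "\<lambda>\<epsilon>. scalar_mat (Lambda_mat n \<epsilon> z) - Ph"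
  have "selfadjoint P"
    using nc_eval_star[OF assms(2), where p = p] assms(3,8) by (simp add: selfadjoint_def)
  then obtain y where y: "is_inv (scalar_elem z - P) y"
    using invertible_resolvent_selfadjoint assms(10) by blast
  then have inv_y: "ring_inv (scalar_elem z - P) = y" and inv_elem: "invertible_elem (scalar_elem z - P)"
    by (auto simp: is_inv_def invertible_elem_def intro: ring_inv_eqI)
  obtain u v q where n: "n \<ge> 1" and u: "u \<in> carrier_mat 1 (n - 1)" and v: "v \<in> carrier_mat (n - 1) 1"
    and q: "q \<in> carrier_mat (n - 1) (n - 1)" "invertible_mat q"
    and ph_eq: "ph = four_block_mat (0\<^sub>m 1 1) u v q"
    and p_eq: "mat 1 1 (\<lambda>_. p) = - (u * mat_inv q * v)"
    using assms(7) by (auto simp: selfadjoint_linearization_def linearization_def)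
  \<comment> \<open>The size of the lower right block; it is 0 when n = 1, and the block formulas
    cover that case too.\<close>
  define k where "k = n - 1"
  have n_eq: "n = 1 + k" using n by (simp add: k_def)
  note u = u[folded k_def] and v = v[folded k_def] and q = q[folded k_def]
  define U V Q Q' where "U = map_mat (nc_eval X) u" and "V = map_mat (nc_eval X) v"
    and "Q = map_mat (nc_eval X) q" and "Q' = map_mat (nc_eval X) (mat_inv q)"
  have q': "is_mat_inv k q (mat_inv q)" using q by (rule is_mat_inv_mat_inv)
  then have q'_car: "mat_inv q \<in> carrier_mat k k" by (simp add: is_mat_inv_def)
  have Q: "is_mat_inv k Q Q'" unfolding Q_def Q'_def by (rule is_mat_inv_map_nc_eval[OF q'])
  then have Q_car: "Q \<in> carrier_mat k k" "Q' \<in> carrier_mat k k" by (auto simp: is_mat_inv_def)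
  have U: "U \<in> carrier_mat 1 k" and V: "V \<in> carrier_mat k 1" using u v by (auto simp: U_def V_def)
  have UQV_car: "U * Q' \<in> carrier_mat 1 k" "U * Q' * V \<in> carrier_mat 1 1"
    using U V Q_car by auto
  have "map_mat (nc_eval X) (u * mat_inv q * v) = U * Q' * V"
    using map_mat_nc_eval_mult[OF mult_carrier_mat[OF u q'_car] v, of X]
      map_mat_nc_eval_mult[OF u q'_car, of X] by (simp add: U_def V_def Q'_def)
  moreover have "map_mat (nc_eval X) (mat 1 1 (\<lambda>_. - p)) = mat 1 1 (\<lambda>_. - P)"
    using assms(8) by (intro eq_matI) (auto simp: nc_eval_minus)
  moreover have "u * mat_inv q * v = mat 1 1 (\<lambda>_. - p)"
  proof -
    have "u * mat_inv q * v = - mat 1 1 (\<lambda>_. p)" unfolding p_eq by simp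
    also have "\<dots> = mat 1 1 (\<lambda>_. - p)" by (intro eq_matI) auto
    finally show ?thesis .
  qed
  ultimately have UQV: "U * Q' * V = mat 1 1 (\<lambda>_. - P)" by simp
  have Ph: "Ph = four_block_mat (0\<^sub>m 1 1) U V Q"
    using u v q(1) unfolding assms(9) ph_eq U_def V_def Q_def
    by (subst map_four_block_mat) (auto intro!: cong_four_block_mat)
  have Ph_car: "Ph \<in> carrier_mat n n" using Q_car unfolding Ph n_eq by (intro four_block_carrier_mat) auto
  \<comment> \<open>At \<epsilon> = 0 the lower right block is exactly -Q, whose inverse -Q' is
    already known.\<close>
  have W0: "?W 0 = four_block_mat (mat 1 1 (\<lambda>_. scalar_elem z)) (- U) (- V) (- Q)"
    using U V Q_car unfolding Ph n_eq
    by (intro eq_matI) (auto simp: scalar_mat_def Lambda_mat_def scalar_elem_def)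
  \<comment> \<open>The three signs leave a single minus. As U Q' V = -P, the product is P and the
    Schur complement is z - P.\<close>
  have "- U * - Q' * - V = - (U * Q' * V)"
    using carrier_matD[OF U] carrier_matD[OF V] carrier_matD[OF Q_car(2)] by simp
  then have S: "mat 1 1 (\<lambda>_. scalar_elem z) - - U * - Q' * - V = mat 1 1 (\<lambda>_. scalar_elem z - P)"
    unfolding UQV by (intro eq_matI) auto
  define R where "R = four_block_mat (mat 1 1 (\<lambda>_. y))
    (- (mat 1 1 (\<lambda>_. y) * (- U * - Q'))) (- (- Q' * - V * mat 1 1 (\<lambda>_. y)))
    (- Q' + - Q' * - V * mat 1 1 (\<lambda>_. y) * (- U * - Q'))"
  have R: "is_mat_inv n (?W 0) R"
    unfolding W0 unfolding n_eq R_def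
  proof (rule is_mat_inv_four_block)
    show "is_mat_inv k (- Q) (- Q')" by (rule is_mat_inv_uminus[OF Q])
    show "is_mat_inv 1 (mat 1 1 (\<lambda>_. scalar_elem z) - - U * - Q' * - V) (mat 1 1 (\<lambda>_. y))"
      unfolding S using y is_mat_inv_one_block by blast
  qed (use U V in auto)
  have R00: "R $$ (0, 0) = y" by (simp add: R_def)
  have cauchy: "cauchy_transform \<phi> P z = \<phi> y" by (simp add: cauchy_transform_def inv_y)
  \<comment> \<open>By uniqueness any explicit inverse may stand in for
    \<open>mat_inv\<close>.\<close>
  have entry: "mat_cauchy_transform \<phi> Ph (Lambda_mat n \<epsilon> z) $$ (0, 0) = \<phi> (B $$ (0, 0))"
    if "is_mat_inv n (?W \<epsilon>) B" for \<epsilon> B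
  proof -
    have "B \<in> carrier_mat n n" using that by (simp add: is_mat_inv_def)
    then show ?thesis
      using n carrier_matD[of B n n] is_mat_inv_imp(2)[OF that] by (simp add: mat_cauchy_transform_def)
  qed
  \<comment> \<open>Continuity of inversion at \<epsilon> = 0 yields both the invertibility for
    small \<epsilon> and the convergence of the inverses.\<close>
  have "mat_tendsto ?W (?W 0) n n (at_right 0)"
    by (intro mat_tendsto_minus mat_tendsto_Lambda_mat mat_tendsto_const Ph_car)
  from mat_tendsto_inverse[OF this R] obtain B where B: "mat_tendsto B R n n (at_right 0)"
    and inv: "\<forall>\<^sub>F \<epsilon> in at_right 0. is_mat_inv n (?W \<epsilon>) (B \<epsilon>)" by blast
  have "((\<lambda>\<epsilon>. \<phi> (B \<epsilon> $$ (0, 0))) \<longlongrightarrow> \<phi> y) (at_right 0)"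
    using B n R00 by (intro bounded_linear.tendsto[OF bounded_linear_state[OF assms(1)]])
      (auto simp: mat_tendsto_def)
  moreover have "\<forall>\<^sub>F \<epsilon> in at_right 0. \<phi> (B \<epsilon> $$ (0, 0))
      = mat_cauchy_transform \<phi> Ph (Lambda_mat n \<epsilon> z) $$ (0, 0)"
    using inv by eventually_elim (simp add: entry)
  \<comment> \<open>B agrees with the actual inverse only for small \<epsilon>, so the limit is
    transferred along an eventual equality.\<close>
  ultimately have "((\<lambda>\<epsilon>. mat_cauchy_transform \<phi> Ph (Lambda_mat n \<epsilon> z) $$ (0, 0))
      \<longlongrightarrow> cauchy_transform \<phi> P z) (at_right 0)"
    unfolding cauchy by (rule Lim_transform_eventually)
  moreover have "\<forall>\<^sub>F \<epsilon> in at_right 0. invertible_mat (?W \<epsilon>)"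
    using inv by eventually_elim (rule is_mat_inv_imp(1))
  moreover have "invertible_mat (?W 0)" by (rule is_mat_inv_imp(1)[OF R])
  ultimately show ?thesis
    using inv_elem entry[OF R] by (simp add: cauchy R00)
qed

end
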